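(* For every finite $n\ge1$ there exists a differential cancellation meadow with formal variables $X_1,\dots,X_n$. More precisely, the quotient $T(\Sigma_m(\overline X))/{\equiv_{ZTC}}$ is a cancellation meadow in which every element is represented either by $0$ or by $p/q$ with $p$ and $q$ polynomials in $X_1,\dots,X_n$ not equal to the $0$-polynomial; the operators $\frac{\partial}{\partial X_i}$ ($i=1,\dots,n$) given on it by $$\frac{\partial}{\partial X_i}(0)=0,\qquad \frac{\partial}{\partial X_i}\Big(\frac pq\Big)=\frac{\frac{\partial}{\partial X_i}(p)\cdot q-p\cdot\frac{\partial}{\partial X_i}(q)}{q^2}$$ for nonzero polynomials $p,q$ (where on the right-hand side $\frac{\partial}{\partial X_i}$ is the usual formal partial derivative of polynomials) are well defined, i.e. independent of the chosen representation; and $T(\Sigma_m(\overline X))/{\equiv_{ZTC}}$ expanded with these operators, and with the constants $X_1,\dots,X_n$ interpreted by their own classes, is a differential cancellation meadow.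
   Context: The signature of meadows is $\Sigma_m=(0,1,+,\cdot,-,{}^{-1})$. A meadow is a $\Sigma_m$-algebra satisfying the set $\mathit{Md}$ of equations: $(x+y)+z=x+(y+z)$; $x+y=y+x$; $x+0=x$; $x+(-x)=0$; $(x\cdot y)\cdot z=x\cdot(y\cdot z)$; $x\cdot y=y\cdot x$; $1\cdot x=x$; $x\cdot(y+z)=x\cdot y+x\cdot z$; $(x^{-1})^{-1}=x$; $x\cdot(x\cdot x^{-1})=x$. We write $p/q$ for $p\cdot q^{-1}$. A cancellation meadow is a meadow that also satisfies the Inverse Law $x\ne0\Longrightarrow x\cdot x^{-1}=1$. A differential meadow with formal variables $X_1,\dots,X_n$ is a meadow equipped with constants $X_1,\dots,X_n$ and unary operators $\frac{\partial}{\partial X_i}$ ($1\le i\le n$) satisfying the set $\mathit{DE}$ of equations, for all $i,j\in\{1,\dots,n\}$: (D1) $\frac{\partial}{\partial X_i}(x+y)=\frac{\partial}{\partial X_i}(x)+\frac{\partial}{\partial X_i}(y)$; (D2) $\frac{\partial}{\partial X_i}(x\cdot y)=\frac{\partial}{\partial X_i}(x)\cdot y+x\cdot\frac{\partial}{\partial X_i}(y)$; (D3) $\frac{\partial}{\partial X_i}(x\cdot x^{-1})=0$; (D4) $\frac{\partial}{\partial X_i}(X_i)=1$; (D5) $\frac{\partial}{\partial X_i}(X_j)=0$ if $i\ne j$. It is a differential cancellation meadow if in addition the underlying meadow is a cancellation meadow. Let $\mathbb C_0$ be the field of complex numbers with inverse made total by $0^{-1}=0$. Let $T(\Sigma_m(\overline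 X))$ be the set of terms $t(X_1,\dots,X_n)$ built from $X_1,\dots,X_n$ using the operations and constants of $\Sigma_m$. "Polynomial" has the conventional meaning, not involving division: a polynomial in $X_1,\dots,X_n$ given by a term without the inverse operation (hence with integer coefficients). For $V\subseteq\mathbb C_0^n$, write $t\equiv^V_{\mathbb C_0^n}r$ if $t$ and $r$ evaluate to equal values in $\mathbb C_0$ under every assignment of $(X_1,\dots,X_n)$ to a point of $V$. A subset of $\mathbb C_0^n$ is Z-open if it is open in the Zariski topology on $\mathbb C^n$. The relation $\equiv_{ZTC}$ (Zariski Topology Congruence) on $T(\Sigma_m(\overline X))$ is defined by: $t\equiv_{ZTC}r$ if and only if there is a non-empty Z-open set $V\subseteq\mathbb C_0^n$ such that $t\equiv^V_{\mathbb C_0^n}r$. This is a congruence for the operations of $\Sigma_m$, and the quotient $T(\Sigma_m(\overline X))/{\equiv_{ZTC}}$ carries the induced $\Sigma_m$-operations. *)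

theory Defs
  imports Complex_Main "HOL-Library.Poly_Mapping" "HOL-Algebra.Ring"
begin

section \<open>Meadows and differential meadows\<close>

text \<open>
  The signature of meadows is that of HOL-Algebra's rings together with total unary
  operations for the additive and the multiplicative inverse. These are operations of the
  algebra, unlike the operators \<open>a_inv\<close> and \<open>m_inv\<close> of HOL-Algebra, which are derived from
  addition and multiplication.
\<close>

record 'a meadow_sig = "'a ring" +
  neg :: "'a \<Rightarrow> 'a"
  minv :: "'a \<Rightarrow> 'a"

locale meadow =
  fixes M :: "('a, 'b) meadow_sig_scheme" (structure)
  assumes zero_closed: "\<zero> \<in> carrier M"
    and one_closed: "\<one> \<in> carrier M"
    and add_closed: "\<lbrakk>x \<in> carrier M; y \<in> carrier M\<rbrakk> \<Longrightarrow> x \<oplus> y \<in> carrier M"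
    and mult_closed: "\<lbrakk>x \<in> carrier M; y \<in> carrier M\<rbrakk> \<Longrightarrow> x \<otimes> y \<in> carrier M"
    and neg_closed: "x \<in> carrier M \<Longrightarrow> neg M x \<in> carrier M"
    and minv_closed: "x \<in> carrier M \<Longrightarrow> minv M x \<in> carrier M"
    and add_assoc: "\<lbrakk>x \<in> carrier M; y \<in> carrier M; z \<in> carrier M\<rbrakk>
      \<Longrightarrow> (x \<oplus> y) \<oplus> z = x \<oplus> (y \<oplus> z)"
    and add_comm: "\<lbrakk>x \<in> carrier M; y \<in> carrier M\<rbrakk> \<Longrightarrow> x \<oplus> y = y \<oplus> x"
    and add_zero: "x \<in> carrier M \<Longrightarrow> x \<oplus> \<zero> = x"
    and add_neg: "x \<in> carrier M \<Longrightarrow> x \<oplus> neg M x = \<zero>"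
    and mult_assoc: "\<lbrakk>x \<in> carrier M; y \<in> carrier M; z \<in> carrier M\<rbrakk>
      \<Longrightarrow> (x \<otimes> y) \<otimes> z = x \<otimes> (y \<otimes> z)"
    and mult_comm: "\<lbrakk>x \<in> carrier M; y \<in> carrier M\<rbrakk> \<Longrightarrow> x \<otimes> y = y \<otimes> x"
    and one_mult: "x \<in> carrier M \<Longrightarrow> \<one> \<otimes> x = x"
    and distrib: "\<lbrakk>x \<in> carrier M; y \<in> carrier M; z \<in> carrier M\<rbrakk>
      \<Longrightarrow> x \<otimes> (y \<oplus> z) = x \<otimes> y \<oplus> x \<otimes> z"
    and minv_minv: "x \<in> carrier M \<Longrightarrow> minv M (minv M x) = x"
    and restricted_inverse: "x \<in> carrier M \<Longrightarrow> x \<otimes> (x \<otimes> minv M x) = x"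

locale cancellation_meadow = meadow +
  assumes inverse_law: "\<lbrakk>x \<in> carrier M; x \<noteq> \<zero>\<rbrakk> \<Longrightarrow> x \<otimes> minv M x = \<one>"

text \<open>
  The formal variables are indexed by a finite type \<open>'n\<close>, which plays the role of the
  index set of size \<open>n \<ge> 1\<close>.
\<close>

locale differential_meadow = meadow M
  for M :: "('a, 'b) meadow_sig_scheme" (structure) +
  fixes X :: "'n::finite \<Rightarrow> 'a"
    and D :: "'n \<Rightarrow> 'a \<Rightarrow> 'a"
  assumes X_closed: "X i \<in> carrier M"
    and D_closed: "x \<in> carrier M \<Longrightarrow> D i x \<in> carrier M"
    and D1: "\<lbrakk>x \<in> carrier M; y \<in> carrier M\<rbrakk> \<Longrightarrow> D i (x \<oplus> y) = D i x \<oplus> D i y"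
    and D2: "\<lbrakk>x \<in> carrier M; y \<in> carrier M\<rbrakk> \<Longrightarrow> D i (x \<otimes> y) = D i x \<otimes> y \<oplus> x \<otimes> D i y"
    and D3: "x \<in> carrier M \<Longrightarrow> D i (x \<otimes> minv M x) = \<zero>"
    and D4: "D i (X i) = \<one>"
    and D5: "i \<noteq> j \<Longrightarrow> D i (X j) = \<zero>"

locale differential_cancellation_meadow = differential_meadow + cancellation_meadow


section \<open>Polynomials in the variables indexed by a finite type\<close>

text \<open>A monomial is given by its exponents, a polynomial by its coefficients.\<close>

type_synonym ('n, 'a) mpoly = "('n \<Rightarrow>\<^sub>0 nat) \<Rightarrow>\<^sub>0 'a"

definition mpoly_var :: "'n \<Rightarrow> ('n, 'a::zero_neq_one) mpoly" where
  "mpoly_var i = Poly_Mapping.single (Poly_Mapping.single i 1) 1"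

definition mpoly_eval :: "('n::finite \<Rightarrow> 'a) \<Rightarrow> ('n, 'a::comm_semiring_1) mpoly \<Rightarrow> 'a" where
  "mpoly_eval x p =
    (\<Sum>m\<in>Poly_Mapping.keys p. Poly_Mapping.lookup p m * (\<Prod>i\<in>UNIV. x i ^ Poly_Mapping.lookup m i))"

text \<open>
  The exponent of \<open>i\<close> is decremented by truncated subtraction; monomials not containing \<open>i\<close>
  contribute nothing, since the new coefficient has the old exponent as a factor.
\<close>

definition mpoly_pderiv :: "'n \<Rightarrow> ('n, 'a::comm_semiring_1) mpoly \<Rightarrow> ('n, 'a) mpoly" where
  "mpoly_pderiv i p =
    (\<Sum>m\<in>Poly_Mapping.keys p.
      Poly_Mapping.single (m - Poly_Mapping.single i 1)
        (of_nat (Poly_Mapping.lookup m i) * Poly_Mapping.lookup p m))"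


section \<open>The Zariski topology on complex affine space\<close>

definition zariski_closed :: "('n::finite \<Rightarrow> complex) set \<Rightarrow> bool" where
  "zariski_closed C \<longleftrightarrow> (\<exists>S :: ('n, complex) mpoly set. C = {x. \<forall>p\<in>S. mpoly_eval x p = 0})"

definition zariski_open :: "('n::finite \<Rightarrow> complex) set \<Rightarrow> bool" where
  "zariski_open V \<longleftrightarrow> zariski_closed (- V)"


section \<open>Terms and Zariski topology congruence\<close>

datatype 'n mterm =
    Zero
  | One
  | Var 'n
  | Add "'n mterm" "'n mterm"
  | Mul "'n mterm" "'n mterm"
  | Neg "'n mterm"
  | Inv "'n mterm"

abbreviation Sub :: "'n mterm \<Rightarrow> 'n mterm \<Rightarrow> 'n mterm" where
  "Sub p q \<equiv> Add p (Neg q)"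

abbreviation Frac :: "'n mterm \<Rightarrow> 'n mterm \<Rightarrow> 'n mterm" where
  "Frac p q \<equiv> Mul p (Inv q)"

text \<open>HOL's division by zero convention \<open>inverse 0 = 0\<close> is that of the meadow of complex numbers.\<close>

primrec term_eval :: "('n \<Rightarrow> complex) \<Rightarrow> 'n mterm \<Rightarrow> complex" where
  "term_eval x Zero = 0"
| "term_eval x One = 1"
| "term_eval x (Var i) = x i"
| "term_eval x (Add s t) = term_eval x s + term_eval x t"
| "term_eval x (Mul s t) = term_eval x s * term_eval x t"
| "term_eval x (Neg t) = - term_eval x t"
| "term_eval x (Inv t) = inverse (term_eval x t)"

definition equiv_on :: "('n \<Rightarrow> complex) set \<Rightarrow> 'n mterm \<Rightarrow> 'n mterm \<Rightarrow> bool" where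
  "equiv_on V t r \<longleftrightarrow> (\<forall>x\<in>V. term_eval x t = term_eval x r)"

definition ztc :: "('n::finite mterm \<times> 'n mterm) set" where
  "ztc = {(t, r). \<exists>V. zariski_open V \<and> V \<noteq> {} \<and> equiv_on V t r}"

definition ztc_class :: "'n::finite mterm \<Rightarrow> 'n mterm set" where
  "ztc_class t = ztc `` {t}"

text \<open>
  The operations on the quotient are the induced ones. Since \<open>ztc\<close> is a congruence, each of
  the unions below is the union of copies of one single class.
\<close>

definition ztc_meadow :: "'n::finite mterm set meadow_sig" where
  "ztc_meadow =
    \<lparr> carrier = UNIV // ztc,
      mult = (\<lambda>A B. \<Union>s\<in>A. \<Union>t\<in>B. ztc_class (Mul s t)),
      one = ztc_class One,
      zero = ztc_class Zero,
      add = (\<lambda>A B. \<Union>s\<in>A. \<Union>t\<in>B. ztc_class (Add s t)),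
      neg = (\<lambda>A. \<Union>t\<in>A. ztc_class (Neg t)),
      minv = (\<lambda>A. \<Union>t\<in>A. ztc_class (Inv t)) \<rparr>"


section \<open>Polynomials as terms, and partial derivatives of fractions\<close>

text \<open>
  \<open>denotes t p\<close> means that \<open>t\<close> is a term without the inverse operation which, read as a
  formal expression, is the polynomial \<open>p\<close>.
\<close>

inductive denotes :: "'n mterm \<Rightarrow> ('n, int) mpoly \<Rightarrow> bool" where
  "denotes Zero 0"
| "denotes One 1"
| "denotes (Var i) (mpoly_var i)"
| "\<lbrakk>denotes s p; denotes t q\<rbrakk> \<Longrightarrow> denotes (Add s t) (p + q)"
| "\<lbrakk>denotes s p; denotes t q\<rbrakk> \<Longrightarrow> denotes (Mul s t) (p * q)"
| "denotes t p \<Longrightarrow> denotes (Neg t) (- p)"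

definition nonzero_polynomial :: "'n mterm \<Rightarrow> bool" where
  "nonzero_polynomial t \<longleftrightarrow> (\<exists>p. denotes t p \<and> p \<noteq> 0)"

definition formal_pderiv :: "'n \<Rightarrow> 'n mterm \<Rightarrow> 'n mterm \<Rightarrow> bool" where
  "formal_pderiv i t t' \<longleftrightarrow> (\<exists>p. denotes t p \<and> denotes t' (mpoly_pderiv i p))"

text \<open>
  \<open>pderiv_rel i A B\<close> holds if the defining equations of the \<open>i\<close>-th partial derivative, applied
  to some representation of the class \<open>A\<close>, yield the class \<open>B\<close>. The operator is well defined
  iff every class is related to exactly one class.
\<close>

inductive pderiv_rel :: "'n::finite \<Rightarrow> 'n mterm set \<Rightarrow> 'n mterm set \<Rightarrow> bool" for i where
  pderiv_zero: "pderiv_rel i (ztc_class Zero) (ztc_class Zero)"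
| pderiv_frac: "\<lbrakk>nonzero_polynomial p; nonzero_polynomial q;
      formal_pderiv i p p'; formal_pderiv i q q'\<rbrakk>
    \<Longrightarrow> pderiv_rel i (ztc_class (Frac p q))
          (ztc_class (Frac (Sub (Mul p' q) (Mul p q')) (Mul q q)))"

definition ztc_pderiv :: "'n::finite \<Rightarrow> 'n mterm set \<Rightarrow> 'n mterm set" where
  "ztc_pderiv i A = (THE B. pderiv_rel i A B)"

end

theory Submission
  imports "HOL-Computational_Algebra.Polynomial" Defs
begin

text \<open>
  Restricting two polynomials to the line through a point where the one and a point where the
  other does not vanish gives nonzero univariate polynomials, so nonempty Zariski open sets
  generate a proper filter, and \<open>ztc\<close> is equality of values eventually along it. By induction
  every term is generically a quotient of integer polynomials, where the denominator, and the
  numerator unless it is zero, are generically nonzero; this gives the inverse law.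

  The partial derivatives are treated analytically. If two terms agree generically, then at a
  generic point they agree near that point along each coordinate line, so their complex partial
  derivatives agree generically. The quotient rule says that \<open>pderiv_rel\<close> relates the class of a
  term to the class of its partial derivative, whence well-definedness follows from the uniqueness
  of derivatives, and the axioms for differential meadows from the rules of calculus.
\<close>

section \<open>Evaluation and differentiation of multivariate polynomials\<close>

text \<open>Updating at a key outside the support amounts to adding a single monomial, so additive
  claims reduce to single monomials.\<close>

lemma mpoly_induct [case_names zero add_single]:
  assumes "P 0"
    and "\<And>p m a. P p \<Longrightarrow> P (p + Poly_Mapping.single m a)"
  shows "P (p :: 'k \<Rightarrow>\<^sub>0 'a::comm_monoid_add)"
proof (induction p rule: update_induct)
  case const
  show ?case by (fact assms(1))
next
  case (update f a b)
  then have "Poly_Mapping.update a b f = f + Poly_Mapping.single a b"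
    by (intro poly_mapping_eqI)
      (auto simp: lookup_update lookup_add lookup_single when_def in_keys_iff)
  with update assms(2) show ?case by metis
qed

definition monomial_value :: "('n::finite \<Rightarrow> 'b) \<Rightarrow> ('n \<Rightarrow>\<^sub>0 nat) \<Rightarrow> 'b::comm_semiring_1" where
  "monomial_value x m = (\<Prod>i\<in>UNIV. x i ^ Poly_Mapping.lookup m i)"

lemma monomial_value_0 [simp]: "monomial_value x 0 = 1"
  by (simp add: monomial_value_def)

lemma monomial_value_add: "monomial_value x (m + m') = monomial_value x m * monomial_value x m'"
  by (simp add: monomial_value_def lookup_add power_add prod.distrib)

lemma monomial_value_single [simp]: "monomial_value x (Poly_Mapping.single i k) = x i ^ k"
proof -
  have "monomial_value x (Poly_Mapping.single i k) = (\<Prod>j\<in>UNIV. if j = i then x j ^ k else 1)"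
    unfolding monomial_value_def by (intro prod.cong) (auto simp: lookup_single when_def)
  then show ?thesis by simp
qed

lemma monomial_value_at_0:
  "monomial_value (\<lambda>_. 0 :: 'b::comm_semiring_1) m = (if m = 0 then 1 else 0)"
proof (cases "m = 0")
  case False
  then obtain i where "Poly_Mapping.lookup m i \<noteq> 0"
    by (metis lookup_zero poly_mapping_eqI)
  then have "\<exists>i\<in>UNIV. (0 :: 'b) ^ Poly_Mapping.lookup m i = 0"
    by (intro bexI[of _ i]) (simp_all add: zero_power)
  with False show ?thesis
    unfolding monomial_value_def by (simp add: prod_zero)
qed simp

lemma monomial_value_split:
  "monomial_value x m
    = x i ^ Poly_Mapping.lookup m i * (\<Prod>j\<in>UNIV - {i}. x j ^ Poly_Mapping.lookup m j)"
  unfolding monomial_value_def by (rule prod.remove) auto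

lemma monomial_value_has_field_derivative:
  fixes x :: "'n::finite \<Rightarrow> complex"
  shows "((\<lambda>h. monomial_value (x(i := h)) m) has_field_derivative
    of_nat (Poly_Mapping.lookup m i) * monomial_value x (m - Poly_Mapping.single i 1)) (at (x i))"
proof -
  let ?k = "Poly_Mapping.lookup m i"
  let ?r = "\<Prod>j\<in>UNIV - {i}. x j ^ Poly_Mapping.lookup m j"
  have 1: "monomial_value (x(i := h)) m = h ^ ?k * ?r" for h
  proof -
    have "(\<Prod>j\<in>UNIV - {i}. (x(i := h)) j ^ Poly_Mapping.lookup m j) = ?r"
      by (intro prod.cong) auto
    then show ?thesis
      by (subst monomial_value_split[of _ _ i]) simp
  qed
  \<comment> \<open>For \<open>?k = 0\<close> truncated subtraction gives a wrong exponent on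
    neither side alone but on both alike, and the factor \<open>of_nat ?k\<close> removes the
    summand from the derivative.\<close>
  have 2: "monomial_value x (m - Poly_Mapping.single i 1) = x i ^ (?k - 1) * ?r"
  proof -
    have "(\<Prod>j\<in>UNIV - {i}. x j ^ Poly_Mapping.lookup (m - Poly_Mapping.single i 1) j) = ?r"
      by (intro prod.cong) (auto simp: lookup_minus lookup_single when_def)
    then show ?thesis
      by (subst monomial_value_split[of _ _ i]) (simp add: lookup_minus)
  qed
  have "((\<lambda>h. h ^ ?k * ?r) has_field_derivative of_nat ?k * x i ^ (?k - 1) * ?r) (at (x i))"
    by (auto intro!: derivative_eq_intros)
  then show ?thesis
    unfolding 1 2 by (simp add: mult.assoc)
qed

section \<open>Coefficients of formal partial derivatives\<close>

lemma mpoly_pderiv_0 [simp]: "mpoly_pderiv i 0 = 0"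
  by (simp add: mpoly_pderiv_def)

lemma mpoly_pderiv_add: "mpoly_pderiv i (p + q) = mpoly_pderiv i p + mpoly_pderiv i q"
  unfolding mpoly_pderiv_def
  by (rule setsum_keys_plus_distrib) (simp_all add: distrib_left single_add)

lemma mpoly_pderiv_single:
  "mpoly_pderiv i (Poly_Mapping.single m a)
    = Poly_Mapping.single (m - Poly_Mapping.single i 1) (of_nat (Poly_Mapping.lookup m i) * a)"
  by (cases "a = 0") (simp_all add: mpoly_pderiv_def)

lemma lookup_mpoly_pderiv:
  "Poly_Mapping.lookup (mpoly_pderiv i p) m
    = of_nat (Poly_Mapping.lookup m i + 1) * Poly_Mapping.lookup p (m + Poly_Mapping.single i 1)"
proof (induction p rule: mpoly_induct)
  case (add_single p m' a)
  \<comment> \<open>Truncated subtraction loses information only when \<open>m'\<close> does not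
    contain \<open>i\<close>; the exponent condition excludes that case, in which the new
    coefficient is 0 anyway.\<close>
  have "m' - Poly_Mapping.single i 1 = m \<and> Poly_Mapping.lookup m' i \<noteq> 0
      \<longleftrightarrow> m' = m + Poly_Mapping.single i 1"
  proof
    assume *: "m' - Poly_Mapping.single i 1 = m \<and> Poly_Mapping.lookup m' i \<noteq> 0"
    have "m' = m' - Poly_Mapping.single i 1 + Poly_Mapping.single i 1"
      using conjunct2[OF *] by (intro poly_mapping_eqI) (auto simp: lookup_add lookup_minus lookup_single when_def)
    with * show "m' = m + Poly_Mapping.single i 1" by simp
  qed (simp add: lookup_add)
  then have "Poly_Mapping.lookup (mpoly_pderiv i (Poly_Mapping.single m' a)) m
      = of_nat (Poly_Mapping.lookup m i + 1)
        * Poly_Mapping.lookup (Poly_Mapping.single m' a) (m + Poly_Mapping.single i 1)"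
    by (cases "m' = m + Poly_Mapping.single i 1")
      (auto simp: mpoly_pderiv_single lookup_single lookup_add when_def)
  then show ?case
    by (simp only: mpoly_pderiv_add lookup_add[of "mpoly_pderiv i p"] lookup_add[of p]
      add_single.IH distrib_left)
qed simp

text \<open>
  The coefficient map \<open>c\<close> covers both integer polynomials evaluated at complex points and
  complex polynomials.
\<close>

locale coeff_hom =
  fixes c :: "'a::comm_ring_1 \<Rightarrow> 'b::comm_ring_1"
  assumes c_0: "c 0 = 0"
    and c_1: "c 1 = 1"
    and c_add: "c (a + b) = c a + c b"
    and c_mult: "c (a * b) = c a * c b"
begin

definition eval :: "('n::finite \<Rightarrow> 'b) \<Rightarrow> ('n, 'a) mpoly \<Rightarrow> 'b" where
  "eval x p = (\<Sum>m\<in>Poly_Mapping.keys p. c (Poly_Mapping.lookup p m) * monomial_value x m)"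

lemma eval_0 [simp]: "eval x 0 = 0"
  by (simp add: eval_def)

lemma eval_single: "eval x (Poly_Mapping.single m a) = c a * monomial_value x m"
  by (cases "a = 0") (simp_all add: eval_def c_0)

lemma eval_1 [simp]: "eval x 1 = 1"
  using eval_single[of x 0 1] by (simp add: c_1)

lemma eval_var [simp]: "eval x (mpoly_var i) = x i"
  unfolding mpoly_var_def eval_single by (simp add: c_1)

lemma eval_add: "eval x (p + q) = eval x p + eval x q"
  unfolding eval_def by (rule setsum_keys_plus_distrib) (simp_all add: c_0 c_add distrib_right)

lemma eval_uminus: "eval x (- p) = - eval x p"
  using eval_add[of x p "- p"] by (simp add: eq_neg_iff_add_eq_0 add.commute)

text \<open>Both sides are additive in \<open>p\<close> and in \<open>q\<close>, so it suffices to
  compare them on two monomials; the left factor is reduced last.\<close>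

lemma eval_mult: "eval x (p * q) = eval x p * eval x q"
proof -
  have "eval x (Poly_Mapping.single m a * q) = c a * monomial_value x m * eval x q" for m a
  proof (induction q rule: mpoly_induct)
    case (add_single q m' b)
    then show ?case
      by (simp add: distrib_left eval_add mult_single eval_single c_mult monomial_value_add
        mult_ac)
  qed simp
  then show ?thesis
    by (induction p rule: mpoly_induct) (simp_all add: distrib_right eval_add eval_single)
qed

lemma c_of_nat: "c (of_nat k) = of_nat k"
  by (induction k) (simp_all add: c_0 c_1 c_add)

text \<open>Every monomial other than the constant one vanishes at the origin. This is the base case
  for recovering coefficients from values.\<close>

lemma eval_at_0: "eval (\<lambda>_. 0) p = c (Poly_Mapping.lookup p 0)"
  by (induction p rule: mpoly_induct)
    (simp_all add: eval_add eval_single monomial_value_at_0 lookup_add c_0 c_add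
      lookup_single when_def)

end


locale complex_coeff_hom = coeff_hom c for c :: "'a::comm_ring_1 \<Rightarrow> complex"
begin

text \<open>The bridge from algebra to analysis: formal derivatives are complex derivatives along
  coordinate lines, monomial by monomial.\<close>

lemma eval_has_field_derivative:
  "((\<lambda>h. eval (x(i := h)) p) has_field_derivative eval x (mpoly_pderiv i p)) (at (x i))"
proof (induction p rule: mpoly_induct)
  case (add_single p m a)
  have "((\<lambda>h. c a * monomial_value (x(i := h)) m) has_field_derivative
      c a * (of_nat (Poly_Mapping.lookup m i) * monomial_value x (m - Poly_Mapping.single i 1)))
      (at (x i))"
    by (intro DERIV_cmult monomial_value_has_field_derivative)
  from DERIV_add[OF add_single.IH this] show ?case
    by (simp add: eval_add mpoly_pderiv_add mpoly_pderiv_single eval_single c_mult c_of_nat mult_ac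
      del: fun_upd_apply)
qed simp

text \<open>
  If all values vanish, so do those of all iterated partial derivatives, whose values at the
  origin are nonzero multiples of the coefficients.
\<close>

lemma lookup_eq_0_if_eval_eq_0:
  assumes "\<And>x. eval x p = 0"
  shows "c (Poly_Mapping.lookup p m) = 0"
  using assms
\<comment> \<open>Induction on the total degree of \<open>m\<close>; \<open>p\<close> varies because
  the hypothesis is applied to a partial derivative of \<open>p\<close>.\<close>
proof (induction "\<Sum>i\<in>UNIV. Poly_Mapping.lookup m i" arbitrary: p m rule: less_induct)
  case less
  show ?case
  proof (cases "m = 0")
    case True
    with less.prems eval_at_0[of p] show ?thesis by simp
  next
    case False
    then obtain i where i: "Poly_Mapping.lookup m i \<noteq> 0"
      by (metis lookup_zero poly_mapping_eqI)
    define m' where "m' = m - Poly_Mapping.single i 1"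
    have m: "m = m' + Poly_Mapping.single i 1"
      using i unfolding m'_def
      by (intro poly_mapping_eqI) (auto simp: lookup_add lookup_minus lookup_single when_def)
    have "(\<Sum>j\<in>UNIV. Poly_Mapping.lookup m' j) < (\<Sum>j\<in>UNIV. Poly_Mapping.lookup m j)"
      by (rule sum_strict_mono_ex1) (auto simp: m lookup_add intro!: exI[of _ i])
    moreover have "eval x (mpoly_pderiv i p) = 0" for x
      using DERIV_unique[OF eval_has_field_derivative[of x i p, unfolded less.prems] DERIV_const] .
    ultimately have "c (Poly_Mapping.lookup (mpoly_pderiv i p) m') = 0"
      by (rule less.hyps)
    then have "of_nat (Poly_Mapping.lookup m' i + 1) * c (Poly_Mapping.lookup p m) = 0"
      by (simp only: lookup_mpoly_pderiv c_mult c_of_nat m)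
    then show ?thesis
      by (metis Suc_eq_plus1 mult_eq_0_iff of_nat_neq_0)
  qed
qed

end

lemma complex_coeff_hom_id: "complex_coeff_hom (\<lambda>a. a)"
  by unfold_locales simp_all

lemma eval_id_eq_mpoly_eval: "coeff_hom.eval (\<lambda>a::complex. a) = mpoly_eval"
proof (intro ext)
  show "coeff_hom.eval (\<lambda>a::complex. a) x p = mpoly_eval x p" for x p
    unfolding coeff_hom.eval_def[OF complex_coeff_hom.axioms[OF complex_coeff_hom_id]]
      mpoly_eval_def monomial_value_def ..
qed

interpretation ceval: complex_coeff_hom "\<lambda>a::complex. a"
  rewrites "coeff_hom.eval (\<lambda>a::complex. a) = mpoly_eval"
  by (rule complex_coeff_hom_id eval_id_eq_mpoly_eval)+

interpretation zeval: complex_coeff_hom "of_int :: int \<Rightarrow> complex"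
  by unfold_locales simp_all

text \<open>A nonzero integer coefficient stays nonzero in the complex numbers, so the values cannot
  all vanish.\<close>

lemma int_mpoly_nonzero_value:
  assumes "p \<noteq> 0"
  obtains x where "zeval.eval x p \<noteq> 0"
proof -
  from assms obtain m where "Poly_Mapping.lookup p m \<noteq> 0"
    by (metis lookup_zero poly_mapping_eqI)
  then show thesis
    using zeval.lookup_eq_0_if_eval_eq_0[of p m] that by auto
qed


section \<open>The filter of nonempty Zariski open sets\<close>

text \<open>Substituting the linear polynomials \<open>[:a i, b i:]\<close> for the variables makes
  the restriction to a line univariate.\<close>

lemma mpoly_eval_line:
  "\<exists>r. \<forall>t. poly r t = mpoly_eval (\<lambda>i. a i + t * b i) p"
proof
  show "\<forall>t. poly (\<Sum>m\<in>Poly_Mapping.keys p. smult (Poly_Mapping.lookup p m)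
      (\<Prod>i\<in>UNIV. [:a i, b i:] ^ Poly_Mapping.lookup m i)) t = mpoly_eval (\<lambda>i. a i + t * b i) p"
    by (simp add: mpoly_eval_def poly_sum poly_prod)
qed

lemma mpoly_eval_common_nonzero:
  fixes p q :: "('n::finite, complex) mpoly"
  assumes "mpoly_eval a p \<noteq> 0" and "mpoly_eval b q \<noteq> 0"
  shows "\<exists>x. mpoly_eval x p \<noteq> 0 \<and> mpoly_eval x q \<noteq> 0"
proof -
  obtain r where r: "\<forall>t. poly r t = mpoly_eval (\<lambda>i. a i + t * (b i - a i)) p"
    using mpoly_eval_line[of a "\<lambda>i. b i - a i" p] ..
  obtain s where s: "\<forall>t. poly s t = mpoly_eval (\<lambda>i. a i + t * (b i - a i)) q"
    using mpoly_eval_line[of a "\<lambda>i. b i - a i" q] ..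
  \<comment> \<open>The line passes through \<open>a\<close> at parameter 0 and through
    \<open>b\<close> at parameter 1.\<close>
  have "poly r 0 \<noteq> 0" "poly s 1 \<noteq> 0"
    unfolding r[rule_format] s[rule_format] using assms by simp_all
  then have "r \<noteq> 0" "s \<noteq> 0" by (metis poly_0)+
  then have "r * s \<noteq> 0" by (rule no_zero_divisors)
  then obtain t where "poly (r * s) t \<noteq> 0"
    by (metis poly_all_0_iff_0)
  then have "poly r t \<noteq> 0" "poly s t \<noteq> 0" by simp_all
  then show ?thesis unfolding r[rule_format] s[rule_format] by blast
qed

lemma zariski_open_nonzero_set: "zariski_open {x. mpoly_eval x p \<noteq> 0}"
  unfolding zariski_open_def zariski_closed_def by (rule exI[of _ "{p}"]) auto

text \<open>A point of \<open>V\<close> lies outside the zero set, so one of the defining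
  polynomials is nonzero there; its nonvanishing set already lies in \<open>V\<close>.\<close>

lemma zariski_open_basic:
  assumes "zariski_open V" "V \<noteq> {}"
  obtains p a where "mpoly_eval a p \<noteq> 0" "{x. mpoly_eval x p \<noteq> 0} \<subseteq> V"
proof -
  from assms(1) obtain S where S: "- V = {x. \<forall>p\<in>S. mpoly_eval x p = 0}"
    unfolding zariski_open_def zariski_closed_def by blast
  from assms(2) obtain a where "a \<in> V" by blast
  with S obtain p where "p \<in> S" "mpoly_eval a p \<noteq> 0" by blast
  with S show thesis by (intro that[of a p]) auto
qed

text \<open>Encoded as a filter so that finitely many generic conditions combine without handling
  open sets.\<close>

definition generic :: "('n::finite \<Rightarrow> complex) filter" where
  "generic = Abs_filter (\<lambda>P. \<exists>V. zariski_open V \<and> V \<noteq> {} \<and> (\<forall>x\<in>V. P x))"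

lemma eventually_generic:
  fixes P :: "('n::finite \<Rightarrow> complex) \<Rightarrow> bool"
  shows "eventually P generic \<longleftrightarrow> (\<exists>V. zariski_open V \<and> V \<noteq> {} \<and> (\<forall>x\<in>V. P x))"
  unfolding generic_def
proof (rule eventually_Abs_filter, rule is_filter.intro)
  have "zariski_open (UNIV :: ('n \<Rightarrow> complex) set)"
    using zariski_open_nonzero_set[of "1 :: ('n, complex) mpoly"] by simp
  then show "\<exists>V :: ('n \<Rightarrow> complex) set. zariski_open V \<and> V \<noteq> {} \<and> (\<forall>x\<in>V. True)"
    by blast
next
  fix P Q :: "('n \<Rightarrow> complex) \<Rightarrow> bool"
  assume "\<exists>V. zariski_open V \<and> V \<noteq> {} \<and> (\<forall>x\<in>V. P x)"
    and "\<exists>V. zariski_open V \<and> V \<noteq> {} \<and> (\<forall>x\<in>V. Q x)"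
  then obtain p a q b where
    p: "mpoly_eval a p \<noteq> 0" "\<And>x. mpoly_eval x p \<noteq> 0 \<Longrightarrow> P x" and
    q: "mpoly_eval b q \<noteq> 0" "\<And>x. mpoly_eval x q \<noteq> 0 \<Longrightarrow> Q x"
    by (metis (mono_tags, lifting) zariski_open_basic mem_Collect_eq subsetD)
  \<comment> \<open>The product does not vanish exactly where both factors do not, which yields a
    basic open set inside the intersection.\<close>
  have "{x. mpoly_eval x (p * q) \<noteq> 0} \<noteq> {}"
    using mpoly_eval_common_nonzero[OF p(1) q(1)] by (auto simp: ceval.eval_mult)
  moreover have "\<forall>x\<in>{x. mpoly_eval x (p * q) \<noteq> 0}. P x \<and> Q x"
    using p(2) q(2) by (auto simp: ceval.eval_mult)
  ultimately show "\<exists>V. zariski_open V \<and> V \<noteq> {} \<and> (\<forall>x\<in>V. P x \<and> Q x)"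
    using zariski_open_nonzero_set by blast
qed blast

text \<open>Properness: a condition that fails everywhere cannot hold generically, so generic
  contradictions are genuine ones.\<close>

lemma generic_neq_bot [simp]: "generic \<noteq> bot"
  by (auto simp: trivial_limit_def eventually_generic)

lemma eventually_generic_mpoly:
  "eventually P generic \<longleftrightarrow>
    (\<exists>p a. mpoly_eval a p \<noteq> 0 \<and> (\<forall>x. mpoly_eval x p \<noteq> 0 \<longrightarrow> P x))"
proof
  assume "eventually P generic"
  then show "\<exists>p a. mpoly_eval a p \<noteq> 0 \<and> (\<forall>x. mpoly_eval x p \<noteq> 0 \<longrightarrow> P x)"
    unfolding eventually_generic using zariski_open_basic by (metis (mono_tags, lifting) mem_Collect_eq subsetD)
next
  assume "\<exists>p a. mpoly_eval a p \<noteq> 0 \<and> (\<forall>x. mpoly_eval x p \<noteq> 0 \<longrightarrow> P x)"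
  then obtain p a where "mpoly_eval a p \<noteq> 0" "\<And>x. mpoly_eval x p \<noteq> 0 \<Longrightarrow> P x" by blast
  then show "eventually P generic"
    unfolding eventually_generic
    by (intro exI[of _ "{x. mpoly_eval x p \<noteq> 0}"]) (auto simp: zariski_open_nonzero_set)
qed

text \<open>Polynomials are continuous along coordinate lines, so a basic Zariski open set meets
  such a line in a set open in the usual topology. The filter is \<open>nhds\<close>, which includes
  the point itself, because derivatives are compared there.\<close>

lemma eventually_generic_coordinate:
  assumes "eventually P generic"
  shows "\<forall>\<^sub>F x in generic. \<forall>\<^sub>F h in nhds (x i). P (x(i := h))"
proof -
  obtain p a where p: "mpoly_eval a p \<noteq> 0" "\<And>x. mpoly_eval x p \<noteq> 0 \<Longrightarrow> P x"
    using assms unfolding eventually_generic_mpoly by blast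
  have "\<forall>\<^sub>F h in nhds (x i). P (x(i := h))" if "mpoly_eval x p \<noteq> 0" for x
  proof -
    have "isCont (\<lambda>h. mpoly_eval (x(i := h)) p) (x i)"
      using ceval.eval_has_field_derivative by (rule DERIV_isCont)
    then have "((\<lambda>h. mpoly_eval (x(i := h)) p) \<longlongrightarrow> mpoly_eval x p) (nhds (x i))"
      using tendsto_at_iff_tendsto_nhds[of "\<lambda>h. mpoly_eval (x(i := h)) p" "x i"]
      by (simp add: isCont_def del: fun_upd_apply)
    then have "\<forall>\<^sub>F h in nhds (x i). mpoly_eval (x(i := h)) p \<noteq> 0"
      using that by (rule tendsto_imp_eventually_ne)
    then show ?thesis
      by (rule eventually_mono) (rule p(2))
  qed
  with p(1) show ?thesis unfolding eventually_generic_mpoly by blast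
qed


section \<open>The quotient meadow\<close>

lemma ztc_iff: "(t, r) \<in> ztc \<longleftrightarrow> (\<forall>\<^sub>F x in generic. term_eval x t = term_eval x r)"
  by (simp add: ztc_def equiv_on_def eventually_generic)

lemma equiv_ztc: "equiv UNIV (ztc :: ('n::finite mterm \<times> 'n mterm) set)"
proof (rule equivI)
  show "refl (ztc :: ('n mterm \<times> 'n mterm) set)"
    by (simp add: refl_on_def ztc_iff)
  show "sym (ztc :: ('n mterm \<times> 'n mterm) set)"
    by (auto intro!: symI simp: ztc_iff eq_commute)
  show "trans (ztc :: ('n mterm \<times> 'n mterm) set)"
  proof (rule transI)
    fix r s t :: "'n mterm"
    assume "(r, s) \<in> ztc" "(s, t) \<in> ztc"
    then show "(r, t) \<in> ztc"
      unfolding ztc_iff by eventually_elim simp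
  qed
qed simp

lemma ztc_class_eq_iff:
  "ztc_class t = ztc_class r \<longleftrightarrow> (\<forall>\<^sub>F x in generic. term_eval x t = term_eval x r)"
  unfolding ztc_class_def using eq_equiv_class_iff[OF equiv_ztc] ztc_iff by blast

lemma ztc_class_eqI:
  "(\<And>x. term_eval x t = term_eval x r) \<Longrightarrow> ztc_class t = ztc_class r"
  by (simp add: ztc_class_eq_iff)

text \<open>With its binary analogue, this lets the operations of \<open>ztc_meadow\<close> be
  computed on representatives.\<close>

lemma ztc_unary:
  assumes "\<And>s t. (s, t) \<in> ztc \<Longrightarrow> (f s, f t) \<in> ztc"
  shows "(\<Union>s\<in>ztc_class t. ztc_class (f s)) = ztc_class (f t)"
  unfolding ztc_class_def
proof (rule UN_equiv_class[OF equiv_ztc])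
  show "(\<lambda>s. ztc `` {f s}) respects ztc"
    by (auto intro!: congruentI equiv_class_eq[OF equiv_ztc] assms)
qed simp

lemma ztc_binary:
  assumes "\<And>s s' t t'. \<lbrakk>(s, s') \<in> ztc; (t, t') \<in> ztc\<rbrakk> \<Longrightarrow> (f s t, f s' t') \<in> ztc"
  shows "(\<Union>s\<in>ztc_class s. \<Union>t\<in>ztc_class t. ztc_class (f s t)) = ztc_class (f s t)"
  unfolding ztc_class_def
proof (rule UN_equiv_class2[OF equiv_ztc equiv_ztc])
  show "congruent2 ztc ztc (\<lambda>s t. ztc `` {f s t})"
    by (auto intro!: congruent2I' equiv_class_eq[OF equiv_ztc] assms)
qed simp_all

text \<open>Evaluation is compositional and the inverse is total, so agreement at a point is
  preserved even where a value is 0.\<close>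

lemma ztc_congruence:
  "\<lbrakk>(s, s') \<in> ztc; (t, t') \<in> ztc\<rbrakk> \<Longrightarrow> (Add s t, Add s' t') \<in> ztc"
  "\<lbrakk>(s, s') \<in> ztc; (t, t') \<in> ztc\<rbrakk> \<Longrightarrow> (Mul s t, Mul s' t') \<in> ztc"
  "(t, t') \<in> ztc \<Longrightarrow> (Neg t, Neg t') \<in> ztc"
  "(t, t') \<in> ztc \<Longrightarrow> (Inv t, Inv t') \<in> ztc"
  unfolding ztc_iff by (auto elim: eventually_elim2 eventually_mono)

lemma ztc_meadow_ops [simp]:
  "\<zero>\<^bsub>ztc_meadow\<^esub> = ztc_class Zero"
  "\<one>\<^bsub>ztc_meadow\<^esub> = ztc_class One"
  "ztc_class s \<oplus>\<^bsub>ztc_meadow\<^esub> ztc_class t = ztc_class (Add s t)"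
  "ztc_class s \<otimes>\<^bsub>ztc_meadow\<^esub> ztc_class t = ztc_class (Mul s t)"
  "neg ztc_meadow (ztc_class t) = ztc_class (Neg t)"
  "minv ztc_meadow (ztc_class t) = ztc_class (Inv t)"
  by (simp_all add: ztc_meadow_def ztc_unary ztc_binary ztc_congruence)

lemma ztc_class_in_carrier [simp]: "ztc_class t \<in> carrier ztc_meadow"
  by (simp add: ztc_meadow_def ztc_class_def quotientI)

lemma ztc_meadow_cases:
  assumes "A \<in> carrier ztc_meadow"
  obtains t where "A = ztc_class t"
  using assms unfolding ztc_meadow_def ztc_class_def by (auto elim: quotientE)


section \<open>Fractions of polynomials\<close>

lemma denotes_eval: "denotes t p \<Longrightarrow> term_eval x t = zeval.eval x p"
  by (induction rule: denotes.induct)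
    (simp_all add: zeval.eval_add zeval.eval_mult zeval.eval_uminus)

text \<open>Zariski open sets are given by complex polynomials, while \<open>denotes\<close> yields
  integer ones; this carries the values over.\<close>

lemma denotes_mpoly_eval: "denotes t p \<Longrightarrow> \<exists>q. \<forall>x. mpoly_eval x q = term_eval x t"
proof (induction rule: denotes.induct)
  case 1
  show ?case by (rule exI[of _ 0]) simp
next
  case 2
  show ?case by (rule exI[of _ 1]) simp
next
  case (3 i)
  show ?case by (rule exI[of _ "mpoly_var i"]) simp
next
  case (4 s p t q)
  then show ?case by (metis ceval.eval_add term_eval.simps(4))
next
  case (5 s p t q)
  then show ?case by (metis ceval.eval_mult term_eval.simps(5))
next
  case (6 t p)
  then show ?case by (metis ceval.eval_uminus term_eval.simps(6))
qed

text \<open>The nonvanishing set is itself basic open, and it is nonempty since a nonzero integer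
  polynomial has a nonzero value.\<close>

lemma nonzero_polynomial_generic:
  fixes t :: "'n::finite mterm"
  assumes "nonzero_polynomial t"
  shows "\<forall>\<^sub>F x in generic. term_eval x t \<noteq> 0"
proof -
  obtain p where p: "denotes t p" "p \<noteq> 0"
    using assms unfolding nonzero_polynomial_def by blast
  obtain a where "zeval.eval a p \<noteq> 0"
    using int_mpoly_nonzero_value[OF p(2)] by blast
  moreover obtain q where "\<And>x. mpoly_eval x q = term_eval x t"
    using denotes_mpoly_eval[OF p(1)] by blast
  ultimately show ?thesis
    unfolding eventually_generic_mpoly
    by (intro exI[of _ q] exI[of _ a]) (simp add: denotes_eval[OF p(1)])
qed

definition polynomial_term :: "'n mterm \<Rightarrow> bool" where
  "polynomial_term t \<longleftrightarrow> (\<exists>p. denotes t p)"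

lemma polynomial_term_intros [intro]:
  "polynomial_term Zero" "polynomial_term One" "polynomial_term (Var i)"
  "\<lbrakk>polynomial_term s; polynomial_term t\<rbrakk> \<Longrightarrow> polynomial_term (Add s t)"
  "\<lbrakk>polynomial_term s; polynomial_term t\<rbrakk> \<Longrightarrow> polynomial_term (Mul s t)"
  "polynomial_term t \<Longrightarrow> polynomial_term (Neg t)"
  unfolding polynomial_term_def by (blast intro: denotes.intros)+

lemma nonzero_polynomial_imp_polynomial [intro]:
  "nonzero_polynomial t \<Longrightarrow> polynomial_term t"
  by (auto simp: nonzero_polynomial_def polynomial_term_def)

lemma polynomial_term_cases:
  fixes t :: "'n::finite mterm"
  assumes "polynomial_term t"
  obtains "nonzero_polynomial t" | "\<And>x. term_eval x t = 0"
proof -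
  obtain p where "denotes t p"
    using assms unfolding polynomial_term_def by blast
  then show thesis
    using that denotes_eval[of t p] by (cases "p = 0") (auto simp: nonzero_polynomial_def)
qed

lemma nonzero_polynomial_One: "nonzero_polynomial One"
  unfolding nonzero_polynomial_def using denotes.intros(2) by fastforce

text \<open>Were the product the zero polynomial, it would vanish everywhere, although generically
  its values are products of nonzero numbers.\<close>

lemma nonzero_polynomial_Mul:
  fixes s t :: "'n::finite mterm"
  assumes "nonzero_polynomial s" "nonzero_polynomial t"
  shows "nonzero_polynomial (Mul s t)"
proof -
  have "polynomial_term (Mul s t)"
    using assms by blast
  then show ?thesis
  proof (cases rule: polynomial_term_cases)
    case 2
    have "\<forall>\<^sub>F x in generic. term_eval x (Mul s t) \<noteq> 0"
      using nonzero_polynomial_generic[OF assms(1)] nonzero_polynomial_generic[OF assms(2)]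
      by eventually_elim simp
    with 2 show ?thesis by simp
  qed
qed

lemma term_fraction:
  "\<exists>p q. polynomial_term p \<and> nonzero_polynomial q
    \<and> (\<forall>\<^sub>F x in generic. term_eval x t = term_eval x p / term_eval x q)"
proof (induction t)
  case Zero
  show ?case
    by (intro exI[of _ Zero] exI[of _ One]) (auto simp: nonzero_polynomial_One)
next
  case One
  show ?case
    by (intro exI[of _ One]) (auto simp: nonzero_polynomial_One)
next
  case (Var i)
  show ?case
    by (intro exI[of _ "Var i"] exI[of _ One]) (auto simp: nonzero_polynomial_One)
next
  case (Add s t)
  then obtain p q p' q' where pq:
    "polynomial_term p" "nonzero_polynomial q" "polynomial_term p'" "nonzero_polynomial q'" and
    eq: "\<forall>\<^sub>F x in generic. term_eval x s = term_eval x p / term_eval x q"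
    "\<forall>\<^sub>F x in generic. term_eval x t = term_eval x p' / term_eval x q'"
    by blast
  \<comment> \<open>Only for sums must the denominators be nonzero: the total inverse commutes with
    products, but a common denominator requires cancellation.\<close>
  have "\<forall>\<^sub>F x in generic. term_eval x (Add s t)
      = term_eval x (Add (Mul p q') (Mul p' q)) / term_eval x (Mul q q')"
    using eq nonzero_polynomial_generic[OF pq(2)] nonzero_polynomial_generic[OF pq(4)]
  proof eventually_elim
    case (elim x)
    show ?case
      by (simp only: term_eval.simps elim(1,2) add_frac_eq[OF elim(3,4)])
  qed
  with pq show ?case
    by (intro exI[of _ "Add (Mul p q') (Mul p' q)"] exI[of _ "Mul q q'"])
      (auto intro: nonzero_polynomial_Mul)
next
  case (Mul s t)
  then obtain p q p' q' where pq:
    "polynomial_term p" "nonzero_polynomial q" "polynomial_term p'" "nonzero_polynomial q'" and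
    eq: "\<forall>\<^sub>F x in generic. term_eval x s = term_eval x p / term_eval x q"
    "\<forall>\<^sub>F x in generic. term_eval x t = term_eval x p' / term_eval x q'"
    by blast
  have "\<forall>\<^sub>F x in generic. term_eval x (Mul s t)
      = term_eval x (Mul p p') / term_eval x (Mul q q')"
    using eq by eventually_elim simp
  with pq show ?case
    by (intro exI[of _ "Mul p p'"] exI[of _ "Mul q q'"]) (auto intro: nonzero_polynomial_Mul)
next
  case (Neg t)
  then obtain p q where pq: "polynomial_term p" "nonzero_polynomial q" and
    eq: "\<forall>\<^sub>F x in generic. term_eval x t = term_eval x p / term_eval x q"
    by blast
  have "\<forall>\<^sub>F x in generic. term_eval x (Neg t) = term_eval x (Neg p) / term_eval x q"
    using eq by eventually_elim simp
  with pq show ?case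
    by (intro exI[of _ "Neg p"] exI[of _ q]) auto
next
  case (Inv t)
  then obtain p q where pq: "polynomial_term p" "nonzero_polynomial q" and
    eq: "\<forall>\<^sub>F x in generic. term_eval x t = term_eval x p / term_eval x q"
    by blast
  from pq(1) show ?case
  proof (cases rule: polynomial_term_cases)
    case 1
    have "\<forall>\<^sub>F x in generic. term_eval x (Inv t) = term_eval x q / term_eval x p"
      using eq by eventually_elim simp
    with 1 pq show ?thesis
      by (intro exI[of _ q] exI[of _ p]) auto
  next
    case 2
    \<comment> \<open>The numerator vanishes identically, so the fraction cannot be inverted
      formally; \<open>inverse 0 = 0\<close> gives the value 0 instead.\<close>
    have "\<forall>\<^sub>F x in generic. term_eval x (Inv t) = term_eval x Zero / term_eval x One"
      using eq by eventually_elim (simp add: 2)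
    then show ?thesis
      by (intro exI[of _ Zero] exI[of _ One]) (auto intro: nonzero_polynomial_One)
  qed
qed

lemma ztc_class_fraction_cases:
  obtains "ztc_class t = ztc_class Zero"
  | p q where "nonzero_polynomial p" "nonzero_polynomial q" "ztc_class t = ztc_class (Frac p q)"
proof -
  obtain p q where pq: "polynomial_term p" "nonzero_polynomial q" and
    eq: "\<forall>\<^sub>F x in generic. term_eval x t = term_eval x p / term_eval x q"
    using term_fraction by blast
  from pq(1) show thesis
  proof (cases rule: polynomial_term_cases)
    case 1
    with pq eq show thesis
      by (intro that(2)[of p q]) (simp_all add: ztc_class_eq_iff divide_inverse)
  next
    case 2
    with eq show thesis
      by (intro that(1)) (simp add: ztc_class_eq_iff)
  qed
qed

text \<open>A dichotomy special to fractions of polynomials: a term is generically zero or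
  generically nonzero. The inverse law rests on it.\<close>

lemma ztc_class_neq_Zero_generic:
  assumes "ztc_class t \<noteq> ztc_class Zero"
  shows "\<forall>\<^sub>F x in generic. term_eval x t \<noteq> 0"
proof (cases t rule: ztc_class_fraction_cases)
  case (2 p q)
  from 2(3) have "\<forall>\<^sub>F x in generic. term_eval x t = term_eval x (Frac p q)"
    by (simp add: ztc_class_eq_iff)
  with nonzero_polynomial_generic[OF 2(1)] nonzero_polynomial_generic[OF 2(2)]
  show ?thesis by eventually_elim simp
qed (use assms in simp)

lemma cancellation_meadow_ztc_meadow:
  "cancellation_meadow (ztc_meadow :: 'n::finite mterm set meadow_sig)"
proof
  fix A :: "'n mterm set"
  assume "A \<in> carrier ztc_meadow" "A \<noteq> \<zero>\<^bsub>ztc_meadow\<^esub>"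
  then obtain t where A: "A = ztc_class t" and "ztc_class t \<noteq> ztc_class Zero"
    by (metis ztc_meadow_cases ztc_meadow_ops(1))
  from ztc_class_neq_Zero_generic[OF this(2)]
  have "\<forall>\<^sub>F x in generic. term_eval x (Mul t (Inv t)) = term_eval x One"
    by eventually_elim simp
  then show "A \<otimes>\<^bsub>ztc_meadow\<^esub> minv ztc_meadow A = \<one>\<^bsub>ztc_meadow\<^esub>"
    by (simp add: A ztc_class_eq_iff)
next
  fix A :: "'n mterm set"
  assume "A \<in> carrier ztc_meadow"
  then obtain t where A: "A = ztc_class t"
    by (rule ztc_meadow_cases)
  have "term_eval x (Mul t (Mul t (Inv t))) = term_eval x t" for x
    by (cases "term_eval x t = 0") simp_all
  then show "A \<otimes>\<^bsub>ztc_meadow\<^esub> (A \<otimes>\<^bsub>ztc_meadow\<^esub> minv ztc_meadow A) = A"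
    unfolding A ztc_meadow_ops by (rule ztc_class_eqI)
\<comment> \<open>The remaining equations hold at every point, since the complex numbers satisfy
  them.\<close>
qed ((elim ztc_meadow_cases)?, simp add: ztc_class_eq_iff algebra_simps)+


section \<open>Partial derivatives\<close>

lemma ex_denotes_single_var_power:
  "\<exists>t. denotes t (Poly_Mapping.single (Poly_Mapping.single i k) 1)"
proof (induction k)
  case 0
  show ?case using denotes.intros(2) by auto
next
  case (Suc k)
  then obtain t where "denotes t (Poly_Mapping.single (Poly_Mapping.single i k) 1)" by blast
  then have "denotes (Mul t (Var i))
      (Poly_Mapping.single (Poly_Mapping.single i k) 1 * mpoly_var i)"
    by (intro denotes.intros)
  then show ?case
    by (auto simp: mpoly_var_def mult_single simp flip: single_add)
qed

lemma ex_denotes_monomial: "\<exists>t :: 'n mterm. denotes t (Poly_Mapping.single m 1)"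
proof (induction m rule: mpoly_induct)
  case zero
  show ?case using denotes.intros(2) by auto
next
  case (add_single m i k)
  then obtain s t :: "'n mterm" where "denotes s (Poly_Mapping.single m 1)"
    "denotes t (Poly_Mapping.single (Poly_Mapping.single i k) 1)"
    using ex_denotes_single_var_power[of i k] by blast
  then have "denotes (Mul s t)
      (Poly_Mapping.single m 1 * Poly_Mapping.single (Poly_Mapping.single i k) 1)"
    by (intro denotes.intros)
  then show ?case by (auto simp: mult_single)
qed

lemma ex_denotes_const: "\<exists>t :: 'n mterm. denotes t (Poly_Mapping.single 0 c)"
proof (induction c rule: int_induct[where k = 0])
  case base
  show ?case using denotes.intros(1) by auto
next
  case (step1 c)
  then obtain t :: "'n mterm" where "denotes t (Poly_Mapping.single 0 c)" by blast
  then have "denotes (Add t One) (Poly_Mapping.single 0 c + 1)"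
    by (intro denotes.intros)
  then show ?case by (auto simp: single_add)
next
  case (step2 c)
  then obtain t :: "'n mterm" where "denotes t (Poly_Mapping.single 0 c)" by blast
  then have "denotes (Add t (Neg One)) (Poly_Mapping.single 0 c + - 1)"
    by (intro denotes.intros)
  then show ?case by (auto simp: single_diff)
qed

text \<open>Ensures that the formal derivative of a polynomial term is again given by a
  term.\<close>

lemma ex_denotes: "\<exists>t :: 'n mterm. denotes t p"
proof (induction p rule: mpoly_induct)
  case zero
  show ?case using denotes.intros(1) by auto
next
  case (add_single p m c)
  then obtain r s t :: "'n mterm" where "denotes r p" "denotes s (Poly_Mapping.single m 1)"
    "denotes t (Poly_Mapping.single 0 c)"
    using ex_denotes_monomial ex_denotes_const by blast
  then have "denotes (Add r (Mul s t)) (p + Poly_Mapping.single m 1 * Poly_Mapping.single 0 c)"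
    by (intro denotes.intros)
  then show ?case by (auto simp: mult_single)
qed

lemma ex_formal_pderiv:
  assumes "polynomial_term t"
  obtains t' where "formal_pderiv i t t'"
  using assms ex_denotes unfolding polynomial_term_def formal_pderiv_def by blast

section \<open>Analytic derivatives of terms along coordinate lines\<close>

lemma formal_pderiv_has_field_derivative:
  fixes x :: "'n::finite \<Rightarrow> complex"
  assumes "formal_pderiv i t t'"
  shows "((\<lambda>h. term_eval (x(i := h)) t) has_field_derivative term_eval x t') (at (x i))"
proof -
  obtain p where "denotes t p" "denotes t' (mpoly_pderiv i p)"
    using assms unfolding formal_pderiv_def by blast
  then show ?thesis
    using zeval.eval_has_field_derivative[of x i p] by (simp add: denotes_eval del: fun_upd_apply)
qed

text \<open>Analytic counterpart of \<open>pderiv_rel\<close> for arbitrary terms, free of any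
  choice of numerator and denominator.\<close>

definition generic_deriv :: "'n::finite \<Rightarrow> 'n mterm \<Rightarrow> 'n mterm \<Rightarrow> bool" where
  "generic_deriv i t t' \<longleftrightarrow> (\<forall>\<^sub>F x in generic.
    ((\<lambda>h. term_eval (x(i := h)) t) has_field_derivative term_eval x t') (at (x i)))"

text \<open>Equality at single points would not determine a derivative; generic equality persists
  near generic points along coordinate lines.\<close>

lemma generic_deriv_cong:
  assumes "generic_deriv i t t'" "ztc_class t = ztc_class s"
  shows "generic_deriv i s t'"
proof -
  have "\<forall>\<^sub>F x in generic. \<forall>\<^sub>F h in nhds (x i). term_eval (x(i := h)) t = term_eval (x(i := h)) s"
    using assms(2) unfolding ztc_class_eq_iff by (rule eventually_generic_coordinate)
  with assms(1) show ?thesis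
    unfolding generic_deriv_def
    by eventually_elim (simp add: DERIV_cong_ev del: fun_upd_apply)
qed

lemma generic_deriv_unique:
  assumes "generic_deriv i t t'" "generic_deriv i s s'" "ztc_class t = ztc_class s"
  shows "ztc_class t' = ztc_class s'"
  using generic_deriv_cong[OF assms(1,3)] assms(2)
  unfolding generic_deriv_def ztc_class_eq_iff by eventually_elim (rule DERIV_unique)

lemma generic_deriv_Zero: "generic_deriv i Zero Zero"
  and generic_deriv_One: "generic_deriv i One Zero"
  and generic_deriv_Var: "generic_deriv i (Var j) (if i = j then One else Zero)"
  by (simp_all add: generic_deriv_def)

lemma generic_deriv_Add:
  assumes "generic_deriv i s s'" "generic_deriv i t t'"
  shows "generic_deriv i (Add s t) (Add s' t')"
  using assms unfolding generic_deriv_def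
  by eventually_elim (simp add: DERIV_add del: fun_upd_apply)

lemma generic_deriv_Mul:
  assumes "generic_deriv i s s'" "generic_deriv i t t'"
  shows "generic_deriv i (Mul s t) (Add (Mul s' t) (Mul s t'))"
  using assms unfolding generic_deriv_def
proof eventually_elim
  case (elim x)
  from DERIV_mult[OF elim] show ?case
    by (simp add: ac_simps del: fun_upd_apply)
qed

lemma generic_deriv_Frac:
  assumes "nonzero_polynomial q" "formal_pderiv i p p'" "formal_pderiv i q q'"
  shows "generic_deriv i (Frac p q) (Frac (Sub (Mul p' q) (Mul p q')) (Mul q q))"
  unfolding generic_deriv_def using nonzero_polynomial_generic[OF assms(1)]
proof eventually_elim
  case (elim x)
  \<comment> \<open>The trivial updates \<open>x(i := x i)\<close> match the form in which
    \<open>DERIV_divide\<close> evaluates both functions at the point.\<close>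
  have "((\<lambda>h. term_eval (x(i := h)) p / term_eval (x(i := h)) q) has_field_derivative
      (term_eval x p' * term_eval (x(i := x i)) q - term_eval (x(i := x i)) p * term_eval x q')
        / (term_eval (x(i := x i)) q * term_eval (x(i := x i)) q)) (at (x i))"
    by (intro DERIV_divide formal_pderiv_has_field_derivative assms) (simp add: elim)
  then show ?case
    by (simp add: divide_inverse del: fun_upd_apply)
qed

section \<open>The derivative operators on the quotient\<close>

lemma pderiv_rel_generic_deriv:
  assumes "pderiv_rel i A B"
  obtains t t' where "A = ztc_class t" "B = ztc_class t'" "generic_deriv i t t'"
  using assms
proof cases
  case pderiv_zero
  then show thesis using that generic_deriv_Zero by blast
next
  case (pderiv_frac p q p' q')
  then show thesis using that generic_deriv_Frac by blast
qed

lemma ex_pderiv_rel: "\<exists>B. pderiv_rel i (ztc_class t) B"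
proof (cases t rule: ztc_class_fraction_cases)
  case 1
  then show ?thesis by (simp only:) (rule exI, rule pderiv_zero)
next
  case (2 p q)
  obtain p' q' where "formal_pderiv i p p'" "formal_pderiv i q q'"
    by (meson 2(1,2) ex_formal_pderiv nonzero_polynomial_imp_polynomial)
  then show ?thesis
    unfolding 2(3) by (intro exI) (rule pderiv_frac[OF 2(1,2)])
qed

lemma pderiv_rel_unique: "\<lbrakk>pderiv_rel i A B; pderiv_rel i A C\<rbrakk> \<Longrightarrow> B = C"
  by (metis pderiv_rel_generic_deriv generic_deriv_unique)

lemma pderiv_rel_ztc_pderiv: "pderiv_rel i (ztc_class t) (ztc_pderiv i (ztc_class t))"
  unfolding ztc_pderiv_def by (rule theI') (metis ex_pderiv_rel pderiv_rel_unique)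

text \<open>The operator can be computed from any representative: the class chosen by
  \<open>pderiv_rel\<close> also comes from a generic derivative, and these are unique.\<close>

lemma ztc_pderiv_eqI:
  assumes "generic_deriv i t t'"
  shows "ztc_pderiv i (ztc_class t) = ztc_class t'"
  by (metis assms generic_deriv_unique pderiv_rel_generic_deriv pderiv_rel_ztc_pderiv)

text \<open>Terms containing inverses are covered too: the derivative of a representing fraction, or
  of 0, transfers along equality of classes.\<close>

lemma ex_generic_deriv: "\<exists>t'. generic_deriv i t t'"
  by (metis generic_deriv_cong pderiv_rel_generic_deriv ex_pderiv_rel)

lemma differential_cancellation_meadow_ztc_meadow:
  "differential_cancellation_meadow (ztc_meadow :: 'n::finite mterm set meadow_sig)
    (\<lambda>i. ztc_class (Var i)) ztc_pderiv"
proof -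
  interpret cancellation_meadow "ztc_meadow :: 'n mterm set meadow_sig"
    by (rule cancellation_meadow_ztc_meadow)
  show ?thesis
  proof
    fix i :: 'n and A :: "'n mterm set"
    assume A: "A \<in> carrier ztc_meadow"
    then obtain t t' where t: "A = ztc_class t" "generic_deriv i t t'"
      by (metis ex_generic_deriv ztc_meadow_cases)
    then show "ztc_pderiv i A \<in> carrier ztc_meadow"
      by (simp add: ztc_pderiv_eqI)
    have const: "ztc_pderiv i (ztc_class s) = ztc_class Zero" if "s = Zero \<or> s = One" for s
      using that by (metis ztc_pderiv_eqI generic_deriv_Zero generic_deriv_One)
    \<comment> \<open>By the inverse law the product is the class of 0 or of 1, and both have
      derivative 0.\<close>
    show "ztc_pderiv i (A \<otimes>\<^bsub>ztc_meadow\<^esub> minv ztc_meadow A) = \<zero>\<^bsub>ztc_meadow\<^esub>"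
    proof (cases "A = ztc_class Zero")
      case True
      then have "A \<otimes>\<^bsub>ztc_meadow\<^esub> minv ztc_meadow A = ztc_class Zero"
        by (simp add: ztc_class_eqI)
      with const show ?thesis by simp
    next
      case False
      with A inverse_law[of A] const show ?thesis by simp
    qed
  next
    fix i :: 'n and A B :: "'n mterm set"
    assume "A \<in> carrier ztc_meadow" "B \<in> carrier ztc_meadow"
    then obtain s s' t t' where s: "A = ztc_class s" "generic_deriv i s s'" and
      t: "B = ztc_class t" "generic_deriv i t t'"
      by (metis ex_generic_deriv ztc_meadow_cases)
    note D = ztc_pderiv_eqI[OF s(2)] ztc_pderiv_eqI[OF t(2)]
    show "ztc_pderiv i (A \<oplus>\<^bsub>ztc_meadow\<^esub> B)
        = ztc_pderiv i A \<oplus>\<^bsub>ztc_meadow\<^esub> ztc_pderiv i B"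
      using ztc_pderiv_eqI[OF generic_deriv_Add[OF s(2) t(2)]] by (simp add: s(1) t(1) D)
    show "ztc_pderiv i (A \<otimes>\<^bsub>ztc_meadow\<^esub> B)
        = ztc_pderiv i A \<otimes>\<^bsub>ztc_meadow\<^esub> B \<oplus>\<^bsub>ztc_meadow\<^esub> A \<otimes>\<^bsub>ztc_meadow\<^esub> ztc_pderiv i B"
      using ztc_pderiv_eqI[OF generic_deriv_Mul[OF s(2) t(2)]] by (simp add: s(1) t(1) D)
  next
    fix i j :: 'n
    show "ztc_pderiv i (ztc_class (Var i)) = \<one>\<^bsub>ztc_meadow\<^esub>"
      using ztc_pderiv_eqI[OF generic_deriv_Var[of i i]] by simp
    assume "i \<noteq> j"
    then show "ztc_pderiv i (ztc_class (Var j)) = \<zero>\<^bsub>ztc_meadow\<^esub>"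
      using ztc_pderiv_eqI[OF generic_deriv_Var[of i j]] by simp
  qed simp
qed

theorem mainTheorem3:
  shows
    "(\<exists>(M :: 'n::finite mterm set meadow_sig) (X :: 'n \<Rightarrow> 'n mterm set) D.
        differential_cancellation_meadow M X D)
     \<and> cancellation_meadow (ztc_meadow :: 'n mterm set meadow_sig)
     \<and> (\<forall>A \<in> carrier (ztc_meadow :: 'n mterm set meadow_sig).
          A = ztc_class Zero
          \<or> (\<exists>p q. nonzero_polynomial p \<and> nonzero_polynomial q \<and> A = ztc_class (Frac p q)))
     \<and> (\<forall>i :: 'n. \<forall>A \<in> carrier ztc_meadow. \<exists>!B. pderiv_rel i A B)
     \<and> differential_cancellation_meadow (ztc_meadow :: 'n mterm set meadow_sig)
          (\<lambda>i. ztc_class (Var i)) ztc_pderiv"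
proof (intro conjI ballI allI)
  show "differential_cancellation_meadow (ztc_meadow :: 'n mterm set meadow_sig)
      (\<lambda>i. ztc_class (Var i)) ztc_pderiv"
    by (rule differential_cancellation_meadow_ztc_meadow)
  then show "\<exists>(M :: 'n mterm set meadow_sig) (X :: 'n \<Rightarrow> 'n mterm set) D.
      differential_cancellation_meadow M X D"
    by blast
  show "cancellation_meadow (ztc_meadow :: 'n mterm set meadow_sig)"
    by (rule cancellation_meadow_ztc_meadow)
next
  fix A :: "'n mterm set"
  assume "A \<in> carrier ztc_meadow"
  then show "A = ztc_class Zero
      \<or> (\<exists>p q. nonzero_polynomial p \<and> nonzero_polynomial q \<and> A = ztc_class (Frac p q))"
    by (metis ztc_meadow_cases ztc_class_fraction_cases)
next
  fix i :: 'n and A :: "'n mterm set"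
  assume "A \<in> carrier ztc_meadow"
  then show "\<exists>!B. pderiv_rel i A B"
    by (metis ztc_meadow_cases ex_pderiv_rel pderiv_rel_unique)
qed

end
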